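(* Let $(P_S,Q)$ be a randomized quantizer on $\mathbb{R}^n$. If the error $Q(\mathbf{X},S)-\mathbf{X}$ has a probability density function $f$ when $\mathbf{X}\sim\mathrm{Unif}(\mathcal{X})$ (independent of $S\sim P_S$) for a certain set $\mathcal{X}\subseteq\mathbb{R}^n$ with $0<\mu(\mathcal{X})<\infty$, then the conditional entropy satisfies \[ H(Q(\mathbf{X},S)|S)\ge\log\mu(\mathcal{X})-h_L(f). \] As a result, if the error satisfies $Q(\mathbf{x},S)-\mathbf{x}\sim f$ for every $\mathbf{x}\in\mathbb{R}^n$, then the normalized entropy of the randomized quantizer satisfies $\overline{H}(Q)\ge-h_L(f)$.
   Context: Conventions: $\log$ is to base $2$; $H(\cdot|\cdot)$ is conditional Shannon entropy in bits; $\mu$ is Lebesgue measure on $\mathbb{R}^n$; $B^n$ is the closed unit ball; sets and maps are measurable. Randomized quantizer: a pair $(P_S,Q)$ where $P_S$ is a probability distribution on a set $\mathcal{S}$ and $Q:\mathbb{R}^n\times\mathcal{S}\to\mathbb{R}^n$ is such that $\{Q(\mathbf{x},s):\mathbf{x}\in\mathbb{R}^n\}$ is finite or countable for every $s\in\mathcal{S}$. The input is always independent of the state $S\sim P_S$. Normalized entropy: $\overline{H}(Q):=\limsup_{\tau\to\infty}\big(H(Q(\mathbf{X}_\tau,S)|S)-\log\mu(\tau B^n)\big)$, where $\mathbf{X}_\tau\sim\mathrm{Unif}(\tau B^n)$ is independent of $S\sim P_S$. Layered entropy of a probability density function $f:\mathbb{R}^n\to[0,\infty)$: $h_L(f):=\int_0^\infty\mu(L_t^+(f))\log\mu(L_t^+(f))\,\mathrm{d}t$,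 where $L_t^+(f):=\{\mathbf{z}\in\mathbb{R}^n:f(\mathbf{z})\ge t\}$. *)

theory Defs
  imports "HOL-Probability.Probability"
begin

text \<open>
  Measurability in the input variable is Lebesgue measurability, which includes all
  Borel measurable quantizers. Entropies may be infinite, so they take values in
  \<^typ>\<open>ennreal\<close> or \<^typ>\<open>ereal\<close>; the real-valued entropies of the library's theory
  Information are 0 by convention when the defining integral diverges.
\<close>

definition randomized_quantizer ::
    "'s measure \<Rightarrow> ((real ^ 'n) \<times> 's \<Rightarrow> real ^ 'n) \<Rightarrow> bool" where
  "randomized_quantizer P Q \<longleftrightarrow>
     prob_space P \<and>
     Q \<in> measurable (lebesgue \<Otimes>\<^sub>M P) borel \<and>
     (\<forall>s\<in>space P. countable (range (\<lambda>x. Q (x, s))))"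

text \<open>Shannon entropy in bits of a distribution concentrated on a countable set.\<close>

definition shannon_entropy :: "'a measure \<Rightarrow> ennreal" where
  "shannon_entropy D =
     (\<integral>\<^sup>+ u. ennreal (- (measure D {u} * log 2 (measure D {u}))) \<partial>count_space UNIV)"

text \<open>
  The conditional entropy of \<open>Q (X, S)\<close> given \<open>S\<close> for independent \<open>X\<close> and \<open>S\<close> with
  distributions \<open>PX\<close> and \<open>P\<close>. By independence, the conditional distribution of
  \<open>Q (X, S)\<close> given \<open>S = s\<close> is the distribution of \<open>Q (X, s)\<close>.
\<close>

definition conditional_output_entropy ::
    "(real ^ 'n) measure \<Rightarrow> 's measure \<Rightarrow> ((real ^ 'n) \<times> 's \<Rightarrow> real ^ 'n) \<Rightarrow> ennreal" where
  "conditional_output_entropy PX P Q =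
     (\<integral>\<^sup>+ s. shannon_entropy (distr PX borel (\<lambda>x. Q (x, s))) \<partial>P)"

definition normalized_entropy ::
    "'s measure \<Rightarrow> ((real ^ 'n) \<times> 's \<Rightarrow> real ^ 'n) \<Rightarrow> ereal" where
  "normalized_entropy P Q =
     Limsup at_top (\<lambda>\<tau>::real.
       let B = (\<lambda>x. \<tau> *\<^sub>R x) ` (cball 0 1 :: (real ^ 'n) set) in
         enn2ereal (conditional_output_entropy (uniform_measure lebesgue B) P Q)
         - ereal (log 2 (measure lebesgue B)))"

definition superlevel_set :: "(real ^ 'n \<Rightarrow> real) \<Rightarrow> real \<Rightarrow> (real ^ 'n) set" where
  "superlevel_set f t = {z. f z \<ge> t}"

text \<open>
  The integral over \<open>t\<close> is the integral of the positive part minus that of the negative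
  part (\<^const>\<open>ennreal\<close> maps negative reals to 0), so the values \<open>\<infinity>\<close> and \<open>-\<infinity>\<close> are possible.
  If both parts are infinite, the integral does not exist; the difference is then \<open>\<infinity>\<close>
  by the convention of \<^typ>\<open>ereal\<close>, and lower bounds by \<open>- layered_entropy f\<close> are void.
  For a probability density \<open>f\<close>, all superlevel sets with \<open>t > 0\<close> have finite measure.
\<close>

definition layered_entropy :: "(real ^ 'n \<Rightarrow> real) \<Rightarrow> ereal" where
  "layered_entropy f =
     (let \<phi> = (\<lambda>t. measure lebesgue (superlevel_set f t) * log 2 (measure lebesgue (superlevel_set f t)))
      in enn2ereal (\<integral>\<^sup>+ t\<in>{0<..}. ennreal (\<phi> t) \<partial>lborel)
         - enn2ereal (\<integral>\<^sup>+ t\<in>{0<..}. ennreal (- \<phi> t) \<partial>lborel))"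

end

(* A quantizer with state s partitions the input set A into cells; write m(x,s) for the volume of
   the cell of x. The error is the mixture of the uniform distributions on the reflected and
   translated cells, and the conditional entropy is log mu(A) - E[log m(X,S)]. By the bathtub
   principle, the volumes of the superlevel sets of f majorize the cell volumes: for every c > 0,
   E[min(1, c/m(X,S))] is at least the integral over t of min(mu(L_t), c). Since x ln x is a
   mixture of the hinge functions (x - c)+ and -min(x, c) up to a linear term, integrating over c
   gives E[log m(X,S)] <= h_L(f). Positive and negative parts are kept on separate sides throughout,
   because either integral may be infinite. *)

theory Submission imports Defs begin

section \<open>Majorization for the entropy function\<close>

text \<open>The mixture is Taylor's formula for \<phi>(x) = x ln x around 1: \<phi>(1) = 0, the
  slope there is 1 and the second derivative at c is 1/c. This gives the weight 1/c and the split of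
  the range of c at 1. Below 1 the natural hinge (c - x)+ is traded for min x c: layer volumes tend
  to 0 as t grows, so the integral of (c - mu(L_t))+ over t > 0 is infinite, whereas that of
  min(mu(L_t), c) is at most the integral of mu(L_t), which is 1. The mean of log m(X,S) is brought
  to the shape of an integral of \<phi> by writing log m as (1/m) m log m. The weight 1/m has
  integral 1/mu(A) over each cell of positive volume, so such cells count equally whatever their
  size. With this weight the cell volumes have first moment 1, just as the layer volumes have under
  dt, and the two families become comparable although their total masses need not agree.\<close>

lemma nn_integral_hinge_ge_1:
  fixes x :: real
  assumes "0 \<le> x"
  shows "(\<integral>\<^sup>+c\<in>{1..}. ennreal ((x - c) / c) \<partial>lborel) + ennreal (x - 1)
    = ennreal (x * ln x)"
proof (cases "1 \<le> x")
  case True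
  have "(\<integral>\<^sup>+c\<in>{1..}. ennreal ((x - c) / c) \<partial>lborel)
      = (\<integral>\<^sup>+c. ennreal ((x - c) / c) * indicator {1..x} c \<partial>lborel)"
    by (intro nn_integral_cong) (auto split: split_indicator intro!: ennreal_neg divide_nonpos_pos)
  \<comment> \<open>The antiderivative in c of (x - c) / c is x ln c - c; truncation at 0 by
    \<open>ennreal\<close> has already cut the range at c = x.\<close>
  also have "\<dots> = ennreal ((x * ln x - x) - (x * ln 1 - 1))"
    using True by (intro nn_integral_FTC_Icc)
      (auto intro!: derivative_eq_intros simp: field_simps max_def)
  also have "\<dots> + ennreal (x - 1) = ennreal (x * ln x)"
  proof -
    have "0 \<le> (x * ln x - x) - (x * ln 1 - 1)"
      using ln_le_minus_one[of "1/x"] True by (simp add: ln_div field_simps)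
    then show ?thesis using True by (subst ennreal_plus[symmetric]) auto
  qed
  finally show ?thesis .
next
  case False
  then have "(\<integral>\<^sup>+c\<in>{1..}. ennreal ((x - c) / c) \<partial>lborel) = (\<integral>\<^sup>+c. 0 \<partial>(lborel::real measure))"
    by (intro nn_integral_cong) (auto split: split_indicator intro!: ennreal_neg divide_nonpos_pos)
  moreover have "x * ln x \<le> 0"
    using False assms by (cases "x = 0") (auto simp: mult_nonneg_nonpos)
  ultimately show ?thesis
    using False by (auto simp: ennreal_neg)
qed

text \<open>For 0 < x < 1 the integrand is 1 up to c = x and x / c from there to 1, with total x - x
  ln x; for x \<ge> 1 it is 1 throughout. The linear part min x 1 stays on the right, so that
  nothing is subtracted in \<open>ennreal\<close>.\<close>

lemma nn_integral_hinge_le_1: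
  fixes x :: real
  assumes "0 \<le> x"
  shows "(\<integral>\<^sup>+c\<in>{0<..1}. ennreal (min x c / c) \<partial>lborel)
    = ennreal (- (x * ln x)) + ennreal (min x 1)"
proof (cases "x < 1 \<and> 0 < x")
  case True
  have "(\<integral>\<^sup>+c\<in>{0<..1}. ennreal (min x c / c) \<partial>lborel)
      = (\<integral>\<^sup>+c. indicator {0<..<x} c + ennreal (x / c) * indicator {x..1} c \<partial>lborel)"
    using True by (intro nn_integral_cong) (auto split: split_indicator)
  also have "\<dots> = ennreal x + (\<integral>\<^sup>+c. ennreal (x / c) * indicator {x..1} c \<partial>lborel)"
    using True by (subst nn_integral_add) auto
  also have "(\<integral>\<^sup>+c. ennreal (x / c) * indicator {x..1} c \<partial>lborel) = ennreal (x * ln 1 - x * ln x)"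
    using True by (intro nn_integral_FTC_Icc) (auto intro!: derivative_eq_intros)
  finally show ?thesis
    using True by (simp add: add.commute)
next
  case False
  show ?thesis
  proof (cases "x = 0")
    case True
    have "(\<integral>\<^sup>+c\<in>{0<..1}. ennreal (min x c / c) \<partial>lborel) = (\<integral>\<^sup>+c. 0 \<partial>(lborel::real measure))"
      using True by (intro nn_integral_cong) (auto split: split_indicator)
    then show ?thesis using True by simp
  next
    case nz: False
    with False assms have "1 \<le> x" by auto
    then have "(\<integral>\<^sup>+c\<in>{0<..1}. ennreal (min x c / c) \<partial>lborel)
        = (\<integral>\<^sup>+c. indicator {0<..1} c \<partial>(lborel::real measure))"
      by (intro nn_integral_cong) (auto split: split_indicator)
    then show ?thesis
      using \<open>1 \<le> x\<close> by (simp add: ennreal_neg)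
  qed
qed

text \<open>Tonelli isolates, for each threshold c, the weighted integral of a single hinge, which
  is the quantity that a majorization hypothesis controls.\<close>

lemma nn_integral_weighted_hinge:
  fixes u :: "'a \<Rightarrow> real" and g :: "real \<Rightarrow> real \<Rightarrow> real"
  assumes "sigma_finite_measure M"
    and [measurable]: "u \<in> borel_measurable M" "w \<in> borel_measurable M"
      "case_prod g \<in> borel_measurable (borel \<Otimes>\<^sub>M borel)" "I \<in> sets borel"
    and I: "\<And>c. c \<in> I \<Longrightarrow> 0 < c"
  shows "(\<integral>\<^sup>+x. w x * (\<integral>\<^sup>+c\<in>I. ennreal (g (u x) c / c) \<partial>lborel) \<partial>M)
    = (\<integral>\<^sup>+c\<in>I. ennreal (1 / c) * (\<integral>\<^sup>+x. w x * ennreal (g (u x) c) \<partial>M) \<partial>lborel)"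
proof -
  interpret sigma_finite_measure M by fact
  interpret pair_sigma_finite M "lborel :: real measure" ..
  have "(\<integral>\<^sup>+x. w x * (\<integral>\<^sup>+c\<in>I. ennreal (g (u x) c / c) \<partial>lborel) \<partial>M)
      = (\<integral>\<^sup>+x. \<integral>\<^sup>+c. w x * (ennreal (g (u x) c / c) * indicator I c) \<partial>lborel \<partial>M)"
    by (simp add: nn_integral_cmult)
  also have "\<dots> = (\<integral>\<^sup>+c. \<integral>\<^sup>+x. w x * (ennreal (g (u x) c / c) * indicator I c) \<partial>M \<partial>lborel)"
    by (rule Fubini'[symmetric]) measurable
  also have "\<dots> = (\<integral>\<^sup>+c\<in>I. ennreal (1 / c) * (\<integral>\<^sup>+x. w x * ennreal (g (u x) c) \<partial>M) \<partial>lborel)"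
  proof (intro nn_integral_cong)
    fix c :: real
    show "(\<integral>\<^sup>+x. w x * (ennreal (g (u x) c / c) * indicator I c) \<partial>M)
      = ennreal (1 / c) * (\<integral>\<^sup>+x. w x * ennreal (g (u x) c) \<partial>M) * indicator I c"
    proof (cases "c \<in> I")
      case True
      then have "ennreal (g (u x) c / c) = ennreal (1 / c) * ennreal (g (u x) c)" for x
        using I[of c] by (subst ennreal_mult'[symmetric]) auto
      then show ?thesis
        using True by (simp add: nn_integral_cmult[symmetric] mult.left_commute)
    qed simp
  qed
  finally show ?thesis .
qed

text \<open>In the manner of Hardy, Littlewood and Polya: equal first moments and ordered integrals
  of min(., c) order the integrals of every mixture of hinges. The weights may have infinite total
  mass, so constants cannot be added to the integrands; only the common first moment 1 is available
  for cancellation. Negative parts stand on the opposite side of the inequality, which makes it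
  meaningful when integrals are infinite.\<close>

lemma entropy_majorization_ln:
  fixes u :: "'a \<Rightarrow> real" and v :: "'b \<Rightarrow> real"
  assumes M: "sigma_finite_measure M" and N: "sigma_finite_measure N"
    and mu[measurable]: "u \<in> borel_measurable M" "w \<in> borel_measurable M"
    and mv[measurable]: "v \<in> borel_measurable N" "w' \<in> borel_measurable N"
    and u: "\<And>x. 0 \<le> u x" and v: "\<And>t. 0 \<le> v t"
    and mean_u: "(\<integral>\<^sup>+x. w x * ennreal (u x) \<partial>M) = 1"
    and mean_v: "(\<integral>\<^sup>+t. w' t * ennreal (v t) \<partial>N) = 1"
    and le: "\<And>c. 0 < c \<Longrightarrow> (\<integral>\<^sup>+t. w' t * ennreal (min (v t) c) \<partial>N)
                             \<le> (\<integral>\<^sup>+x. w x * ennreal (min (u x) c) \<partial>M)"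
  shows "(\<integral>\<^sup>+x. w x * ennreal (u x * ln (u x)) \<partial>M) + (\<integral>\<^sup>+t. w' t * ennreal (- (v t * ln (v t))) \<partial>N)
    \<le> (\<integral>\<^sup>+t. w' t * ennreal (v t * ln (v t)) \<partial>N) + (\<integral>\<^sup>+x. w x * ennreal (- (u x * ln (u x))) \<partial>M)"
proof -
  define minu maxu minv maxv
    where "minu c = (\<integral>\<^sup>+x. w x * ennreal (min (u x) c) \<partial>M)"
      and "maxu c = (\<integral>\<^sup>+x. w x * ennreal (u x - c) \<partial>M)"
      and "minv c = (\<integral>\<^sup>+t. w' t * ennreal (min (v t) c) \<partial>N)"
      and "maxv c = (\<integral>\<^sup>+t. w' t * ennreal (v t - c) \<partial>N)" for c
  have split: "ennreal (min x c) + ennreal (x - c) = ennreal x" if "0 < c" "0 \<le> x" for x c :: real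
    using that by (cases "x \<le> c") (auto simp: ennreal_neg ennreal_plus[symmetric] simp del: ennreal_plus)
  have sum_u: "minu c + maxu c = 1" if "0 < c" for c
    unfolding minu_def maxu_def mean_u[symmetric]
    using that u by (subst nn_integral_add[symmetric]) (simp_all add: split distrib_left[symmetric])
  have sum_v: "minv c + maxv c = 1" if "0 < c" for c
    unfolding minv_def maxv_def mean_v[symmetric]
    using that v by (subst nn_integral_add[symmetric]) (simp_all add: split distrib_left[symmetric])
  \<comment> \<open>Since x = min x c + (x - c)+ and both first moments are 1, the order of the
    capped integrals reverses for the excesses.\<close>
  have max_le: "maxu c \<le> maxv c" if "0 < c" for c
  proof -
    have "minv c + maxu c \<le> minv c + maxv c"
      using le[OF that] sum_u[OF that] sum_v[OF that]
      by (metis add_right_mono minu_def minv_def)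
    moreover have "minv c \<noteq> \<top>"
      using sum_v[OF that] by (metis ennreal_add_eq_top ennreal_one_neq_top)
    ultimately show ?thesis
      by (simp add: ennreal_add_left_cancel_le)
  qed
  have Pu: "(\<integral>\<^sup>+x. w x * ennreal (u x * ln (u x)) \<partial>M)
      = (\<integral>\<^sup>+c\<in>{1..}. ennreal (1 / c) * maxu c \<partial>lborel) + maxu 1"
    unfolding maxu_def
    by (subst nn_integral_weighted_hinge[OF M mu, symmetric])
       (auto simp: nn_integral_add[symmetric] distrib_left[symmetric] nn_integral_hinge_ge_1 u)
  have Pv: "(\<integral>\<^sup>+x. w' x * ennreal (v x * ln (v x)) \<partial>N)
      = (\<integral>\<^sup>+c\<in>{1..}. ennreal (1 / c) * maxv c \<partial>lborel) + maxv 1"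
    unfolding maxv_def
    by (subst nn_integral_weighted_hinge[OF N mv, symmetric])
       (auto simp: nn_integral_add[symmetric] distrib_left[symmetric] nn_integral_hinge_ge_1 v)
  have Nu: "(\<integral>\<^sup>+x. w x * ennreal (- (u x * ln (u x))) \<partial>M) + minu 1
      = (\<integral>\<^sup>+c\<in>{0<..1}. ennreal (1 / c) * (\<integral>\<^sup>+x. w x * ennreal (min (u x) c) \<partial>M) \<partial>lborel)"
    unfolding minu_def
    by (subst nn_integral_weighted_hinge[OF M mu, symmetric])
       (auto simp: nn_integral_add[symmetric] distrib_left[symmetric] nn_integral_hinge_le_1[symmetric] u
         intro!: nn_integral_cong arg_cong2[where f="(*)"] split: split_indicator)
  have Nv: "(\<integral>\<^sup>+x. w' x * ennreal (- (v x * ln (v x))) \<partial>N) + minv 1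
      = (\<integral>\<^sup>+c\<in>{0<..1}. ennreal (1 / c) * (\<integral>\<^sup>+x. w' x * ennreal (min (v x) c) \<partial>N) \<partial>lborel)"
    unfolding minv_def
    by (subst nn_integral_weighted_hinge[OF N mv, symmetric])
       (auto simp: nn_integral_add[symmetric] distrib_left[symmetric] nn_integral_hinge_le_1[symmetric] v
         intro!: nn_integral_cong arg_cong2[where f="(*)"] split: split_indicator)
  define Uu Uv Nmu Nmv
    where "Uu = (\<integral>\<^sup>+c\<in>{1..}. ennreal (1 / c) * maxu c \<partial>lborel)"
      and "Uv = (\<integral>\<^sup>+c\<in>{1..}. ennreal (1 / c) * maxv c \<partial>lborel)"
      and "Nmu = (\<integral>\<^sup>+x. w x * ennreal (- (u x * ln (u x))) \<partial>M)"
      and "Nmv = (\<integral>\<^sup>+x. w' x * ennreal (- (v x * ln (v x))) \<partial>N)"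
  have U: "Uu \<le> Uv"
    unfolding Uu_def Uv_def by (intro nn_integral_mono) (auto split: split_indicator intro!: mult_left_mono max_le)
  have V: "Nmv + minv 1 \<le> Nmu + minu 1"
    unfolding Nmu_def Nmv_def Nu Nv
    by (intro nn_integral_mono)
       (auto split: split_indicator intro!: mult_left_mono simp: max_def u v le)
  \<comment> \<open>The linear terms of Taylor's formula cancel here: 1 is written as
    \<open>minv 1 + maxv 1\<close> before the two comparisons and recovered as
    \<open>minu 1 + maxu 1\<close> after them. The finite summand 1 can then be cancelled.\<close>
  have "(Uu + maxu 1 + Nmv) + 1 = Uu + (Nmv + minv 1) + (maxu 1 + maxv 1)"
    using sum_v[of 1] by (simp add: ac_simps)
  also have "\<dots> \<le> Uv + (Nmu + minu 1) + (maxu 1 + maxv 1)"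
    by (intro add_mono U V order_refl)
  also have "\<dots> = (Uv + maxv 1 + Nmu) + 1"
    using sum_u[of 1] by (simp add: ac_simps)
  finally show ?thesis
    unfolding Pu Pv Uu_def[symmetric] Uv_def[symmetric] Nmu_def[symmetric] Nmv_def[symmetric]
    using ennreal_add_left_cancel_le[of 1] by (simp add: add.commute)
qed

lemma entropy_majorization:
  fixes u :: "'a \<Rightarrow> real" and v :: "'b \<Rightarrow> real"
  assumes "sigma_finite_measure M" and "sigma_finite_measure N"
    and [measurable]: "u \<in> borel_measurable M" "w \<in> borel_measurable M"
    and [measurable]: "v \<in> borel_measurable N" "w' \<in> borel_measurable N"
    and "\<And>x. 0 \<le> u x" and "\<And>t. 0 \<le> v t"
    and "(\<integral>\<^sup>+x. w x * ennreal (u x) \<partial>M) = 1"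
    and "(\<integral>\<^sup>+t. w' t * ennreal (v t) \<partial>N) = 1"
    and "\<And>c. 0 < c \<Longrightarrow> (\<integral>\<^sup>+t. w' t * ennreal (min (v t) c) \<partial>N)
                             \<le> (\<integral>\<^sup>+x. w x * ennreal (min (u x) c) \<partial>M)"
  shows "(\<integral>\<^sup>+x. w x * ennreal (u x * log 2 (u x)) \<partial>M) + (\<integral>\<^sup>+t. w' t * ennreal (- (v t * log 2 (v t))) \<partial>N)
    \<le> (\<integral>\<^sup>+t. w' t * ennreal (v t * log 2 (v t)) \<partial>N) + (\<integral>\<^sup>+x. w x * ennreal (- (u x * log 2 (u x))) \<partial>M)"
proof -
  have log: "ennreal (x * log 2 x) = ennreal (1 / ln 2) * ennreal (x * ln x)"
    "ennreal (- (x * log 2 x)) = ennreal (1 / ln 2) * ennreal (- (x * ln x))" for x :: real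
    by (subst ennreal_mult'[symmetric]; simp add: log_def)+
  show ?thesis
    unfolding log
    by (simp only: mult.left_commute[of _ "ennreal (1 / ln 2)"])
       (simp add: nn_integral_cmult distrib_left[symmetric] mult_left_mono entropy_majorization_ln assms)
qed

section \<open>Superlevel sets and the bathtub principle\<close>

lemma emeasure_superlevel_finite:
  fixes f :: "'a \<Rightarrow> real"
  assumes [measurable]: "f \<in> borel_measurable M"
    and "(\<integral>\<^sup>+z. ennreal (f z) \<partial>M) \<noteq> \<infinity>" and "0 < t"
  shows "emeasure M {z\<in>space M. t \<le> f z} < \<infinity>"
proof -
  have "emeasure M {z\<in>space M. 1 \<le> ennreal (1 / t) * ennreal (f z)}
      \<le> ennreal (1 / t) * (\<integral>\<^sup>+z. ennreal (f z) * indicator (space M) z \<partial>M)"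
    by (rule nn_integral_Markov_inequality) auto
  also have "\<dots> < \<infinity>"
    using assms(2) by (auto simp: ennreal_mult_less_top less_top cong: nn_integral_cong)
  also have "{z\<in>space M. 1 \<le> ennreal (1 / t) * ennreal (f z)} = {z\<in>space M. t \<le> f z}"
  proof -
    have "1 \<le> ennreal (1 / t) * ennreal (f z) \<longleftrightarrow> t \<le> f z" for z
    proof -
      have "1 \<le> ennreal (1 / t) * ennreal (f z) \<longleftrightarrow> ennreal 1 \<le> ennreal (f z / t)"
        using \<open>0 < t\<close> by (subst ennreal_mult'[symmetric]) auto
      also have "\<dots> \<longleftrightarrow> t \<le> f z"
        using \<open>0 < t\<close> by (subst ennreal_le_iff2) (auto simp: field_simps)
      finally show ?thesis .
    qed
    then show ?thesis by simp
  qed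
  finally show ?thesis .
qed

text \<open>Each value f z is the length of the interval of levels t with 0 < t \<le> f z. The
  weight h serves two cases: h = 1 gives the first moment of the layer volumes, and the bathtub
  function gives the comparison level by level.\<close>

lemma nn_integral_layer_cake:
  fixes f :: "'a \<Rightarrow> real" and h :: "'a \<Rightarrow> ennreal"
  assumes "sigma_finite_measure M"
    and [measurable]: "f \<in> borel_measurable M" "h \<in> borel_measurable M"
    and f: "\<And>z. 0 \<le> f z"
  shows "(\<integral>\<^sup>+z. h z * ennreal (f z) \<partial>M)
    = (\<integral>\<^sup>+t\<in>{0<..}. (\<integral>\<^sup>+z\<in>{z. t \<le> f z}. h z \<partial>M) \<partial>lborel)"
proof -
  interpret sigma_finite_measure M by fact
  interpret pair_sigma_finite M "lborel :: real measure" ..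
  have "(\<integral>\<^sup>+z. h z * ennreal (f z) \<partial>M)
      = (\<integral>\<^sup>+z. \<integral>\<^sup>+t. h z * indicator {0<..f z} t \<partial>lborel \<partial>M)"
    using f by (simp add: nn_integral_cmult)
  also have "\<dots> = (\<integral>\<^sup>+z. \<integral>\<^sup>+t. h z * (if 0 < t \<and> t \<le> f z then 1 else 0) \<partial>lborel \<partial>M)"
    by (intro nn_integral_cong) (auto split: split_indicator)
  also have "\<dots> = (\<integral>\<^sup>+t. \<integral>\<^sup>+z. h z * (if 0 < t \<and> t \<le> f z then 1 else 0) \<partial>M \<partial>lborel)"
    by (rule Fubini'[symmetric]) measurable
  also have "\<dots> = (\<integral>\<^sup>+t\<in>{0<..}. (\<integral>\<^sup>+z\<in>{z. t \<le> f z}. h z \<partial>M) \<partial>lborel)"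
    by (intro nn_integral_cong) (auto simp: indicator_def cong: if_cong intro!: nn_integral_cong split: split_indicator)
  finally show ?thesis .
qed

text \<open>Bathtub principle: fill the region where \<open>f\<close> is largest up to volume \<open>c\<close>, taking a
  constant fraction of the critical level set.\<close>

lemma bathtub:
  fixes f :: "'a \<Rightarrow> real" and c :: real
  assumes M: "sigma_finite_measure M"
    and [measurable]: "f \<in> borel_measurable M" and f: "\<And>z. 0 \<le> f z"
    and fin: "(\<integral>\<^sup>+z. ennreal (f z) \<partial>M) \<noteq> \<infinity>" and c: "0 < c"
  obtains \<eta> :: "'a \<Rightarrow> ennreal" where "\<eta> \<in> borel_measurable M" "\<And>z. \<eta> z \<le> 1"
    "(\<integral>\<^sup>+z. \<eta> z \<partial>M) \<le> ennreal c"
    "(\<integral>\<^sup>+t\<in>{0<..}. ennreal (min (measure M {z\<in>space M. t \<le> f z}) c) \<partial>lborel) \<le> (\<integral>\<^sup>+z. \<eta> z * ennreal (f z) \<partial>M)"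
proof -
  interpret sigma_finite_measure M by fact
  define E where "E t = {z\<in>space M. t \<le> f z}" for t
  have [measurable]: "E t \<in> sets M" for t unfolding E_def by measurable
  have E_fin: "emeasure M (E t) < \<infinity>" if "0 < t" for t
    unfolding E_def by (rule emeasure_superlevel_finite) (use fin that in auto)
  have E_eq: "emeasure M (E t) = ennreal (measure M (E t))" if "0 < t" for t
    using E_fin[OF that] by (intro emeasure_eq_ennreal_measure) auto
  have E_anti: "E t \<subseteq> E s" if "s \<le> t" for s t
    using that by (auto simp: E_def)
  \<comment> \<open>The supremum of \<open>T\<close> is the critical level. Inserting 0 keeps
    \<open>T\<close> nonempty; the supremum is 0 exactly when no positive level has a superlevel set
    of volume at least c.\<close>
  define T where "T = insert 0 {t. 0 < t \<and> ennreal c \<le> emeasure M (E t)}"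
  obtain K where K: "(\<integral>\<^sup>+z. ennreal (f z) \<partial>M) = ennreal K" "0 \<le> K"
    using fin by (metis ennreal_cases infinity_ennreal_def)
  have T_le: "t \<le> K / c" if "t \<in> T" for t
  proof (cases "t = 0")
    case False
    with that have t: "0 < t" "ennreal c \<le> emeasure M (E t)" by (auto simp: T_def)
    have "ennreal (t * c) \<le> ennreal t * emeasure M (E t)"
      using t c by (simp add: ennreal_mult mult_left_mono)
    also have "\<dots> = (\<integral>\<^sup>+z. ennreal t * indicator (E t) z \<partial>M)"
      by (simp add: nn_integral_cmult_indicator)
    also have "\<dots> \<le> (\<integral>\<^sup>+z. ennreal (f z) \<partial>M)"
      by (intro nn_integral_mono) (auto simp: E_def intro: ennreal_leI split: split_indicator)
    finally show ?thesis
      using K c by (simp add: field_simps ennreal_le_iff)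
  qed (use K c in auto)
  have bdd: "bdd_above T" using T_le by (auto intro!: bdd_aboveI)
  define t0 where "t0 = Sup T"
  have t0: "0 \<le> t0" unfolding t0_def by (rule cSup_upper[OF _ bdd]) (simp add: T_def)
  have above: "emeasure M (E t) < ennreal c" if "t0 < t" for t
  proof (rule ccontr)
    assume "\<not> ?thesis"
    then have "t \<in> T" using that t0 by (auto simp: T_def)
    then have "t \<le> t0" unfolding t0_def by (rule cSup_upper) (rule bdd)
    with that show False by simp
  qed
  have below: "ennreal c \<le> emeasure M (E t)" if "0 < t" "t < t0" for t
  proof -
    obtain s where "s \<in> T" "t < s"
      using \<open>t < t0\<close> less_cSup_iff[OF _ bdd, of t] by (auto simp: t0_def T_def)
    then have "ennreal c \<le> emeasure M (E s)" "E s \<subseteq> E t"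
      using \<open>0 < t\<close> E_anti by (auto simp: T_def)
    then show ?thesis
      by (meson \<open>\<And>t. E t \<in> sets M\<close> emeasure_mono order_trans)
  qed
  define G where "G = {z\<in>space M. t0 < f z}"
  define L where "L = {z\<in>space M. f z = t0}"
  have [measurable]: "G \<in> sets M" "L \<in> sets M" unfolding G_def L_def by measurable
  \<comment> \<open>Continuity from below: \<open>G\<close> is the increasing union of superlevel
    sets strictly above the critical level, each of volume less than c.\<close>
  have G_le: "emeasure M G \<le> ennreal c"
  proof -
    have "G = (\<Union>n. E (t0 + 1 / Suc n))"
    proof safe
      fix z assume z: "z \<in> G"
      then obtain n where "1 / Suc n < f z - t0"
        using reals_Archimedean[of "f z - t0"] by (auto simp: G_def inverse_eq_divide)
      then show "z \<in> (\<Union>n. E (t0 + 1 / Suc n))"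
        using z by (auto simp: E_def G_def intro!: exI[of _ n])
    next
      fix z n assume z: "z \<in> E (t0 + 1 / Suc n)"
      moreover have "0 < 1 / real (Suc n)" by simp
      ultimately have "t0 < f z" unfolding E_def by (metis (lifting) less_add_same_cancel1 less_le_trans mem_Collect_eq)
      then show "z \<in> G" using z by (simp add: E_def G_def)
    qed
    moreover have "incseq (\<lambda>n. E (t0 + 1 / Suc n))"
      by (intro monoI E_anti) (auto simp: field_simps)
    ultimately have "emeasure M G = (SUP n. emeasure M (E (t0 + 1 / Suc n)))"
      by (subst SUP_emeasure_incseq) auto
    also have "\<dots> \<le> ennreal c"
      by (intro SUP_least less_imp_le above) simp
    finally show ?thesis .
  qed
  have E0_ge: "ennreal c \<le> emeasure M (E t0)" if "0 < t0"
  proof -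
    \<comment> \<open>Levels increasing to t0. The shift by 2 keeps even the first one positive (it
      is t0 / 2), so all these superlevel sets have finite volume and continuity from above
      applies.\<close>
    define s where "s n = t0 - t0 / (n + 2)" for n :: nat
    have s: "0 < s n" "s n < t0" for n using that by (auto simp: s_def field_simps intro!: add_pos_nonneg)
    have "E t0 = (\<Inter>n. E (s n))"
    proof safe
      fix z n assume "z \<in> E t0" then show "z \<in> E (s n)" using s[of n] by (auto simp: E_def)
    next
      fix z assume z: "z \<in> (\<Inter>n. E (s n))"
      have "(\<lambda>n. s n) \<longlonglongrightarrow> t0" unfolding s_def by real_asymp
      then have "t0 \<le> f z" by (rule LIMSEQ_le_const2) (use z in \<open>auto simp: E_def\<close>)
      then show "z \<in> E t0" using z by (auto simp: E_def)
    qed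
    moreover have "decseq (\<lambda>n. E (s n))"
      using that by (intro antimonoI E_anti) (auto simp: s_def field_simps)
    ultimately have "emeasure M (E t0) = (INF n. emeasure M (E (s n)))"
      using E_fin[OF s(1)] by (subst INF_emeasure_decseq) (auto simp: less_top)
    also have "\<dots> \<ge> ennreal c"
      by (intro INF_greatest below s)
    finally show ?thesis .
  qed
  \<comment> \<open>The fraction of the critical level set that brings the total volume to exactly
    c. At t0 = 0 the set \<open>L\<close> is the zero set of f, possibly of infinite volume, and is
    left out because it adds nothing to the integral of f. If \<open>L\<close> is null, division by
    zero gives 0, which is right since then \<open>G\<close> already has volume c.\<close>
  define \<theta> where "\<theta> = (if t0 = 0 then 0 else (c - measure M G) / measure M L)"
  have G_eq: "emeasure M G = ennreal (measure M G)" and Gc: "measure M G \<le> c"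
  proof -
    show *: "emeasure M G = ennreal (measure M G)"
      using G_le by (intro emeasure_eq_ennreal_measure) (auto simp: top_unique)
    show "measure M G \<le> c" using G_le c unfolding * by (simp add: ennreal_le_iff)
  qed
  define \<eta> :: "'a \<Rightarrow> ennreal" where "\<eta> z = indicator G z + ennreal \<theta> * indicator L z" for z
  have \<eta>_int: "(\<integral>\<^sup>+z. \<eta> z \<partial>M) = emeasure M G + ennreal \<theta> * emeasure M L"
    unfolding \<eta>_def by (subst nn_integral_add) (auto simp: nn_integral_cmult_indicator)
  have crit: "\<theta> \<le> 1 \<and> 0 \<le> \<theta> \<and> (\<integral>\<^sup>+z. \<eta> z \<partial>M) = ennreal c" if "0 < t0"
  proof -
    have L_fin: "emeasure M L = ennreal (measure M L)"
    proof -
      have "emeasure M L \<le> emeasure M (E t0)"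
        by (intro emeasure_mono) (auto simp: L_def E_def)
      then show ?thesis
        using E_fin[OF that] by (intro emeasure_eq_ennreal_measure) (auto simp: top_unique)
    qed
    have "E t0 = G \<union> L" "G \<inter> L = {}" by (auto simp: E_def G_def L_def)
    then have "emeasure M (E t0) = emeasure M G + emeasure M L"
      by (simp add: plus_emeasure)
    then have sum: "c \<le> measure M G + measure M L"
      using E0_ge[OF that] L_fin G_eq by (simp add: ennreal_plus[symmetric] del: ennreal_plus)
    show ?thesis
    proof (cases "measure M L = 0")
      case True
      then have "measure M G = c" using sum Gc by simp
      then show ?thesis using True L_fin \<eta>_int G_eq by (simp add: \<theta>_def)
    next
      case False
      then have "0 < measure M L" by (simp add: zero_less_measure_iff)
      then have "\<theta> \<le> 1" "0 \<le> \<theta>" "measure M G + \<theta> * measure M L = c"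
        using sum Gc that by (auto simp: \<theta>_def)
      then show ?thesis
        using L_fin \<eta>_int G_eq by (simp add: ennreal_mult[symmetric] ennreal_plus[symmetric] del: ennreal_plus)
    qed
  qed
  have t0_cases: "t0 = 0 \<or> 0 < t0" using t0 by auto
  show thesis
  proof (rule that[of \<eta>])
    show [measurable]: "\<eta> \<in> borel_measurable M" unfolding \<eta>_def by measurable
    show "\<eta> z \<le> 1" for z
      using crit t0_cases by (auto simp: \<eta>_def G_def L_def \<theta>_def split: split_indicator)
    show "(\<integral>\<^sup>+z. \<eta> z \<partial>M) \<le> ennreal c"
      using t0_cases crit G_le \<eta>_int by (auto simp: \<theta>_def)
    \<comment> \<open>Optimality holds at each level separately. Above t0 the superlevel set lies in
      \<open>G\<close>, where \<open>\<eta>\<close> is 1; at or below t0 it contains the whole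
      support of \<open>\<eta>\<close>, whose mass is c.\<close>
    have "ennreal (min (measure M (E t)) c) \<le> (\<integral>\<^sup>+z\<in>{z. t \<le> f z}. \<eta> z \<partial>M)" if "0 < t" for t
    proof (cases "t0 < t")
      case True
      have "ennreal (min (measure M (E t)) c) \<le> emeasure M (E t)"
        using E_eq[OF that] by (simp add: ennreal_leI)
      also have "\<dots> = (\<integral>\<^sup>+z. indicator (E t) z \<partial>M)" by simp
      also have "\<dots> \<le> (\<integral>\<^sup>+z\<in>{z. t \<le> f z}. \<eta> z \<partial>M)"
        using True by (intro nn_integral_mono) (auto simp: \<eta>_def E_def G_def L_def split: split_indicator)
      finally show ?thesis .
    next
      case False
      then have "0 < t0" using that by auto
      have "ennreal (min (measure M (E t)) c) \<le> ennreal c" by (simp add: ennreal_leI)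
      also have "\<dots> = (\<integral>\<^sup>+z. \<eta> z \<partial>M)" using crit \<open>0 < t0\<close> by simp
      also have "\<dots> \<le> (\<integral>\<^sup>+z\<in>{z. t \<le> f z}. \<eta> z \<partial>M)"
        using False by (intro nn_integral_mono) (auto simp: \<eta>_def G_def L_def split: split_indicator)
      finally show ?thesis .
    qed
    then show "(\<integral>\<^sup>+t\<in>{0<..}. ennreal (min (measure M {z\<in>space M. t \<le> f z}) c) \<partial>lborel) \<le> (\<integral>\<^sup>+z. \<eta> z * ennreal (f z) \<partial>M)"
      unfolding nn_integral_layer_cake[OF M \<open>f \<in> borel_measurable M\<close> \<open>\<eta> \<in> borel_measurable M\<close> f] E_def[symmetric]
      by (intro nn_integral_mono) (auto split: split_indicator)
  qed
qed

section \<open>Fibers of a countably valued map\<close>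

text \<open>The probability of the cell containing x. Indexing cells by input points instead of
  output values turns sums over a state-dependent countable set into integrals over inputs, and
  later into one integral over inputs and states.\<close>

definition fiber_prob :: "'a measure \<Rightarrow> ('a \<Rightarrow> 'b) \<Rightarrow> 'a \<Rightarrow> real" where
  "fiber_prob M q x = measure M {y\<in>space M. q y = q x}"

text \<open>The pairs satisfying the equation form a measurable set of the product, and the volumes
  of its sections depend measurably on the parameter. Taking l to be an input gives the fibers of
  one map; taking l to be an input together with a state gives joint measurability of cell
  probabilities.\<close>

lemma measurable_measure_fiber:
  fixes R :: "'l \<times> 'a \<Rightarrow> 'b::{second_countable_topology, t2_space}"
  assumes "prob_space M" and [measurable]: "R \<in> borel_measurable (L \<Otimes>\<^sub>M M)" "r \<in> borel_measurable L"
  shows "(\<lambda>l. measure M {y\<in>space M. R (l, y) = r l}) \<in> borel_measurable L"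
proof -
  interpret prob_space M by fact
  define K where "K = {w\<in>space (L \<Otimes>\<^sub>M M). R w = r (fst w)}"
  have "K \<in> sets (L \<Otimes>\<^sub>M M)" unfolding K_def by measurable
  then have [measurable]: "(\<lambda>l. emeasure M (Pair l -` K)) \<in> borel_measurable L"
    by (rule measurable_emeasure_Pair)
  have "(\<lambda>l. enn2real (emeasure M (Pair l -` K))) \<in> borel_measurable L"
    by measurable
  also have "?this \<longleftrightarrow> ?thesis"
    by (intro measurable_cong) (auto simp: K_def measure_def space_pair_measure vimage_def
        intro!: arg_cong[where f="\<lambda>X. enn2real (emeasure M X)"])
  finally show ?thesis .
qed

lemma measurable_fiber_prob:
  fixes q :: "'a \<Rightarrow> 'b::{second_countable_topology, t2_space}"
  assumes "prob_space M" and [measurable]: "q \<in> borel_measurable M"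
  shows "fiber_prob M q \<in> borel_measurable M"
  using measurable_measure_fiber[OF assms(1), of "\<lambda>w. q (snd w)" M q]
  by (simp add: fiber_prob_def[abs_def])

text \<open>There are only countably many fibers, so the null ones together are still null.\<close>

lemma AE_fiber_prob_pos:
  fixes q :: "'a \<Rightarrow> 'b::{second_countable_topology, t2_space}"
  assumes "prob_space M" and [measurable]: "q \<in> borel_measurable M" and "countable (range q)"
  shows "AE x in M. 0 < fiber_prob M q x"
proof -
  interpret prob_space M by fact
  have "AE x in M. \<forall>u\<in>range q. prob {y\<in>space M. q y = u} = 0 \<longrightarrow> q x \<noteq> u"
  proof (subst AE_ball_countable[OF assms(3)], intro ballI)
    fix u
    show "AE x in M. prob {y\<in>space M. q y = u} = 0 \<longrightarrow> q x \<noteq> u"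
    proof (cases "prob {y\<in>space M. q y = u} = 0")
      case True
      then have "{y\<in>space M. q y = u} \<in> null_sets M"
        by (auto simp: emeasure_eq_measure intro!: null_setsI)
      then have "AE x in M. x \<notin> {y\<in>space M. q y = u}" by (rule AE_not_in)
      with AE_space show ?thesis by eventually_elim auto
    qed simp
  qed
  then show ?thesis
    unfolding fiber_prob_def by eventually_elim (auto simp: zero_less_measure_iff)
qed

text \<open>The tower property for conditioning on the cell. The relation of sharing a cell is
  symmetric and \<open>fiber_prob\<close> is constant on cells, so after exchanging the integrals
  the factor in front of h y is 1/p times p, where p > 0 is the probability of the cell of
  y.\<close>

lemma nn_integral_fiber_average:
  fixes q :: "'a \<Rightarrow> 'b::{second_countable_topology, t2_space}"
  assumes M: "prob_space M" and [measurable]: "q \<in> borel_measurable M" and "countable (range q)"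
    and [measurable]: "h \<in> borel_measurable M"
  shows "(\<integral>\<^sup>+x. h x \<partial>M)
    = (\<integral>\<^sup>+x. ennreal (1 / fiber_prob M q x) * (\<integral>\<^sup>+y\<in>{y. q y = q x}. h y \<partial>M) \<partial>M)"
proof -
  interpret prob_space M by fact
  interpret pair_sigma_finite M M ..
  note [measurable] = measurable_fiber_prob[OF M \<open>q \<in> borel_measurable M\<close>]
  let ?E = "\<lambda>x y. if q y = q x then 1 else 0 :: ennreal"
  have "(\<integral>\<^sup>+x. ennreal (1 / fiber_prob M q x) * (\<integral>\<^sup>+y\<in>{y. q y = q x}. h y \<partial>M) \<partial>M)
      = (\<integral>\<^sup>+x. \<integral>\<^sup>+y. ennreal (1 / fiber_prob M q x) * (h y * ?E x y) \<partial>M \<partial>M)"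
    by (intro nn_integral_cong, subst nn_integral_cmult[symmetric])
       (auto intro!: nn_integral_cong split: split_indicator)
  also have "\<dots> = (\<integral>\<^sup>+y. \<integral>\<^sup>+x. ennreal (1 / fiber_prob M q x) * (h y * ?E x y) \<partial>M \<partial>M)"
    by (rule Fubini'[symmetric]) measurable
  also have "\<dots> = (\<integral>\<^sup>+y. h y \<partial>M)"
  proof (rule nn_integral_cong_AE)
    show "AE y in M. (\<integral>\<^sup>+x. ennreal (1 / fiber_prob M q x) * (h y * ?E x y) \<partial>M) = h y"
      using AE_fiber_prob_pos[OF assms(1-3)] AE_space
    proof eventually_elim
      fix y assume pos: "0 < fiber_prob M q y" and "y \<in> space M"
      have "(\<integral>\<^sup>+x. ennreal (1 / fiber_prob M q x) * (h y * ?E x y) \<partial>M)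
          = (\<integral>\<^sup>+x. (ennreal (1 / fiber_prob M q y) * h y) * indicator {x\<in>space M. q x = q y} x \<partial>M)"
        by (intro nn_integral_cong) (auto simp: fiber_prob_def mult.assoc)
      also have "\<dots> = (ennreal (1 / fiber_prob M q y) * ennreal (fiber_prob M q y)) * h y"
        by (subst nn_integral_cmult_indicator) (simp_all add: emeasure_eq_measure fiber_prob_def mult_ac)
      also have "\<dots> = h y"
        using pos by (simp add: ennreal_mult'[symmetric])
      finally show "(\<integral>\<^sup>+x. ennreal (1 / fiber_prob M q x) * (h y * ?E x y) \<partial>M) = h y" .
    qed
  qed
  finally show ?thesis by simp
qed

text \<open>Entropy is the mean information content of the cell hit by the input. In this form it
  can be compared pointwise with the logarithm of the cell volume, which differs from the
  log-probability by a constant.\<close>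

lemma shannon_entropy_distr_fiber_prob:
  fixes q :: "'a \<Rightarrow> 'b::{second_countable_topology, t2_space}"
  assumes M: "prob_space M" and [measurable]: "q \<in> borel_measurable M" and "countable (range q)"
  shows "shannon_entropy (distr M borel q) = (\<integral>\<^sup>+x. ennreal (- log 2 (fiber_prob M q x)) \<partial>M)"
proof -
  interpret prob_space M by fact
  define d where "d u = prob {y\<in>space M. q y = u}" for u
  have d: "measure (distr M borel q) {u} = d u" for u
    by (subst measure_distr) (auto simp: d_def intro!: arg_cong[where f=prob])
  have d0: "d u = 0" if "u \<notin> range q" for u
  proof -
    have "{y\<in>space M. q y = u} = {}" using that by auto
    then show ?thesis by (simp only: d_def measure_empty)
  qed
  have d1: "0 \<le> d u" "d u \<le> 1" for u by (auto simp: d_def)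
  have "(\<integral>\<^sup>+x. ennreal (- log 2 (fiber_prob M q x)) \<partial>M)
      = (\<integral>\<^sup>+x. \<integral>\<^sup>+u. ennreal (- log 2 (d u)) * indicator {y\<in>space M. q y = u} x \<partial>count_space (range q) \<partial>M)"
  proof (intro nn_integral_cong)
    fix x assume x: "x \<in> space M"
    have "(\<integral>\<^sup>+u. ennreal (- log 2 (d u)) * indicator {y\<in>space M. q y = u} x \<partial>count_space (range q))
        = (\<integral>\<^sup>+u. ennreal (- log 2 (d u)) * indicator {q x} u \<partial>count_space (range q))"
      using x by (intro nn_integral_cong) (auto split: split_indicator)
    also have "\<dots> = ennreal (- log 2 (d (q x)))"
      by (subst nn_integral_indicator_singleton) (auto simp: one_ennreal_def[symmetric])
    finally show "ennreal (- log 2 (fiber_prob M q x))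
      = (\<integral>\<^sup>+u. ennreal (- log 2 (d u)) * indicator {y\<in>space M. q y = u} x \<partial>count_space (range q))"
      by (simp add: fiber_prob_def d_def)
  qed
  also have "\<dots> = (\<integral>\<^sup>+u. \<integral>\<^sup>+x. ennreal (- log 2 (d u)) * indicator {y\<in>space M. q y = u} x \<partial>M \<partial>count_space (range q))"
    by (rule nn_integral_count_space_nn_integral) (auto simp: assms)
  also have "\<dots> = (\<integral>\<^sup>+u. ennreal (- (d u * log 2 (d u))) \<partial>count_space (range q))"
  proof (intro nn_integral_cong)
    fix u
    have "ennreal (- log 2 (d u)) * ennreal (d u) = ennreal (- (d u * log 2 (d u)))"
      using d1[of u] by (subst ennreal_mult''[symmetric]) (auto simp: mult.commute)
    then show "(\<integral>\<^sup>+x. ennreal (- log 2 (d u)) * indicator {y\<in>space M. q y = u} x \<partial>M)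
        = ennreal (- (d u * log 2 (d u)))"
      by (simp add: nn_integral_cmult_indicator emeasure_eq_measure d_def)
  qed
  also have "\<dots> = shannon_entropy (distr M borel q)"
    \<comment> \<open>Values outside the range have probability 0 and contribute 0, so the sum over
      all points reduces to the countable range.\<close>
    unfolding shannon_entropy_def d
    by (subst nn_integral_count_space_indicator)
       (auto intro!: nn_integral_cong simp: d0 split: split_indicator)
  finally show ?thesis by simp
qed

section \<open>Error of a single deterministic quantizer under a uniform input\<close>

lemma nn_integral_reflect_lebesgue:
  fixes a :: "'a::euclidean_space" and g :: "'a \<Rightarrow> ennreal"
  assumes [measurable]: "g \<in> borel_measurable borel"
  shows "(\<integral>\<^sup>+y. g (a - y) \<partial>lebesgue) = (\<integral>\<^sup>+y. g y \<partial>lborel)"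
proof -
  have "(\<integral>\<^sup>+y. g y \<partial>lborel) = (\<integral>\<^sup>+y. g y \<partial>density (distr lborel borel (\<lambda>x. a + (-1) *\<^sub>R x)) (\<lambda>_. \<bar>-1\<bar>^DIM('a)))"
    by (subst lborel_affine[of "-1" a]) (auto simp: one_ennreal.abs_eq[symmetric])
  also have "\<dots> = (\<integral>\<^sup>+y. g (a - y) \<partial>lborel)"
    by (subst nn_integral_density) (auto simp: nn_integral_distr one_ennreal.abs_eq[symmetric])
  finally show ?thesis by (simp add: nn_integral_completion)
qed

lemma prob_space_uniform_lebesgue:
  assumes "0 < emeasure lebesgue A" "emeasure lebesgue A < \<infinity>"
  shows "prob_space (uniform_measure lebesgue A)"
  using assms by (intro prob_space_uniform_measure) auto

lemma nn_integral_uniform_lebesgue_le: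
  assumes A: "A \<in> sets lebesgue" "0 < emeasure lebesgue A" "emeasure lebesgue A < \<infinity>"
    and [measurable]: "g \<in> borel_measurable lebesgue"
    and le: "(\<integral>\<^sup>+x. g x \<partial>lebesgue) \<le> ennreal c" and "0 \<le> c"
  shows "(\<integral>\<^sup>+x. g x \<partial>uniform_measure lebesgue A) \<le> ennreal (c / measure lebesgue A)"
proof -
  have eq: "emeasure lebesgue A = ennreal (measure lebesgue A)"
    using A by (intro emeasure_eq_ennreal_measure) auto
  with A have pos: "0 < measure lebesgue A" by (simp add: ennreal_less_zero_iff)
  have "(\<integral>\<^sup>+x. g x \<partial>uniform_measure lebesgue A) = (\<integral>\<^sup>+x\<in>A. g x \<partial>lebesgue) / emeasure lebesgue A"
    using A by (intro nn_integral_uniform_measure) auto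
  also have "\<dots> \<le> ennreal c / emeasure lebesgue A"
    by (intro divide_right_mono_ennreal order_trans[OF _ le] nn_integral_mono)
       (auto split: split_indicator)
  also have "\<dots> = ennreal (c / measure lebesgue A)"
    using pos \<open>0 \<le> c\<close> by (simp add: eq divide_ennreal)
  finally show ?thesis .
qed

text \<open>On a cell of probability p and volume m = mu(A) p, the integral of \<open>\<eta>\<close>
  of the error has two bounds: p, because \<open>\<eta>\<close> is at most 1, and c / mu(A), because
  the error map preserves volume there and \<open>\<eta>\<close> has total mass at most c. Dividing
  the smaller bound by p gives min(m, c) / m, and averaging over cells gives the claim.\<close>

lemma nn_integral_error_le:
  fixes q :: "'a::euclidean_space \<Rightarrow> 'a" and \<eta> :: "'a \<Rightarrow> ennreal"
  assumes A: "A \<in> sets lebesgue" "0 < emeasure lebesgue A" "emeasure lebesgue A < \<infinity>"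
    and [measurable]: "q \<in> borel_measurable lebesgue" and "countable (range q)"
    and [measurable]: "\<eta> \<in> borel_measurable borel" and le1: "\<And>z. \<eta> z \<le> 1"
    and c: "(\<integral>\<^sup>+z. \<eta> z \<partial>lborel) \<le> ennreal c" "0 \<le> c"
  defines "U \<equiv> uniform_measure lebesgue A"
  defines "m \<equiv> \<lambda>x. measure lebesgue A * fiber_prob U q x"
  shows "(\<integral>\<^sup>+x. \<eta> (q x - x) \<partial>U) \<le> (\<integral>\<^sup>+x. ennreal (1 / m x) * ennreal (min (m x) c) \<partial>U)"
proof -
  have U: "prob_space U" unfolding U_def by (rule prob_space_uniform_lebesgue[OF A(2,3)])
  interpret prob_space U by fact
  have "emeasure lebesgue A = ennreal (measure lebesgue A)"
    using A by (intro emeasure_eq_ennreal_measure) auto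
  with A have pos: "0 < measure lebesgue A" by (simp add: ennreal_less_zero_iff)
  have [measurable_cong]: "sets U = sets lebesgue" by (simp add: U_def)
  have "space U = UNIV" by (simp add: U_def)
  have [measurable]: "(\<lambda>x. x) \<in> borel_measurable lebesgue" by (simp add: measurable_completion)
  have qU: "q \<in> borel_measurable U" by measurable
  have hU: "(\<lambda>x. \<eta> (q x - x)) \<in> borel_measurable U" by measurable
  have "(\<integral>\<^sup>+x. \<eta> (q x - x) \<partial>U)
      = (\<integral>\<^sup>+x. ennreal (1 / fiber_prob U q x) * (\<integral>\<^sup>+y\<in>{y. q y = q x}. \<eta> (q y - y) \<partial>U) \<partial>U)"
    by (rule nn_integral_fiber_average[OF U qU \<open>countable (range q)\<close> hU])
  also have "\<dots> \<le> (\<integral>\<^sup>+x. ennreal (1 / m x) * ennreal (min (m x) c) \<partial>U)"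
  proof (intro nn_integral_mono_AE)
    show "AE x in U. ennreal (1 / fiber_prob U q x) * (\<integral>\<^sup>+y\<in>{y. q y = q x}. \<eta> (q y - y) \<partial>U)
        \<le> ennreal (1 / m x) * ennreal (min (m x) c)"
      using AE_fiber_prob_pos[OF U qU \<open>countable (range q)\<close>]
    proof eventually_elim
      fix x assume p: "0 < fiber_prob U q x"
      have "(\<integral>\<^sup>+y\<in>{y. q y = q x}. \<eta> (q y - y) \<partial>U) \<le> (\<integral>\<^sup>+y. indicator {y\<in>space U. q y = q x} y \<partial>U)"
        using le1 \<open>space U = UNIV\<close> by (intro nn_integral_mono) (auto split: split_indicator)
      also have "\<dots> = ennreal (fiber_prob U q x)"
        by (subst nn_integral_indicator) (auto simp: fiber_prob_def emeasure_eq_measure qU)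
      finally have 1: "(\<integral>\<^sup>+y\<in>{y. q y = q x}. \<eta> (q y - y) \<partial>U) \<le> ennreal (fiber_prob U q x)" .
      \<comment> \<open>On the cell q y is the constant q x, so the error is a reflection and
        translation; the restriction to the cell can then be dropped and the reflection undone on
        the whole space.\<close>
      have "(\<integral>\<^sup>+y\<in>{y. q y = q x}. \<eta> (q y - y) \<partial>U) \<le> (\<integral>\<^sup>+y. \<eta> (q x - y) \<partial>U)"
        by (intro nn_integral_mono) (auto split: split_indicator)
      also have "\<dots> \<le> ennreal (c / measure lebesgue A)"
        unfolding U_def using c
        by (intro nn_integral_uniform_lebesgue_le A) (auto simp: nn_integral_reflect_lebesgue)
      finally have "(\<integral>\<^sup>+y\<in>{y. q y = q x}. \<eta> (q y - y) \<partial>U)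
          \<le> ennreal (min (fiber_prob U q x) (c / measure lebesgue A))"
        using 1 by (simp add: min_def)
      then have "ennreal (1 / fiber_prob U q x) * (\<integral>\<^sup>+y\<in>{y. q y = q x}. \<eta> (q y - y) \<partial>U)
          \<le> ennreal (1 / fiber_prob U q x) * ennreal (min (fiber_prob U q x) (c / measure lebesgue A))"
        by (rule mult_left_mono) simp
      also have "\<dots> = ennreal (1 / m x) * ennreal (min (m x) c)"
        using p pos by (subst (1 2) ennreal_mult'[symmetric]) (auto simp: m_def min_def field_simps)
      finally show "ennreal (1 / fiber_prob U q x) * (\<integral>\<^sup>+y\<in>{y. q y = q x}. \<eta> (q y - y) \<partial>U)
        \<le> ennreal (1 / m x) * ennreal (min (m x) c)" .
    qed
  qed
  finally show ?thesis .
qed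

section \<open>Randomized quantizers\<close>

lemma measurable_fiber_prob_state:
  fixes Q :: "(real ^ 'n) \<times> 's \<Rightarrow> real ^ 'n"
  assumes "randomized_quantizer P Q" and U: "prob_space U" and sets[measurable_cong]: "sets U = sets lebesgue"
  shows "(\<lambda>w. fiber_prob U (\<lambda>y. Q (y, snd w)) (fst w)) \<in> borel_measurable (U \<Otimes>\<^sub>M P)"
proof -
  have [measurable]: "Q \<in> borel_measurable (U \<Otimes>\<^sub>M P)"
    using assms(1) measurable_cong_sets[OF sets_pair_measure_cong[OF sets refl] refl]
    by (auto simp: randomized_quantizer_def)
  show ?thesis
    using measurable_measure_fiber[OF U, of "\<lambda>(l, y). Q (y, snd l)" "U \<Otimes>\<^sub>M P" Q]
    by (simp add: fiber_prob_def)
qed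

text \<open>The averages over state and input merge into one expectation. This matters because f is
  the density of the error mixed over all states: the comparison with its layers is available only
  after averaging over the state, not state by state.\<close>

lemma conditional_output_entropy_fiber_prob:
  fixes Q :: "(real ^ 'n) \<times> 's \<Rightarrow> real ^ 'n"
  assumes rq: "randomized_quantizer P Q" and U: "prob_space U" and sets[measurable_cong]: "sets U = sets lebesgue"
  shows "conditional_output_entropy U P Q
    = (\<integral>\<^sup>+w. ennreal (- log 2 (fiber_prob U (\<lambda>y. Q (y, snd w)) (fst w))) \<partial>(U \<Otimes>\<^sub>M P))"
proof -
  interpret U: prob_space U by fact
  interpret P: prob_space P using rq by (simp add: randomized_quantizer_def)
  interpret pair_sigma_finite U P ..
  have [measurable]: "Q \<in> borel_measurable (U \<Otimes>\<^sub>M P)"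
    using rq measurable_cong_sets[OF sets_pair_measure_cong[OF sets refl] refl]
    by (auto simp: randomized_quantizer_def)
  note [measurable] = measurable_fiber_prob_state[OF assms]
  have "conditional_output_entropy U P Q
      = (\<integral>\<^sup>+s. \<integral>\<^sup>+x. ennreal (- log 2 (fiber_prob U (\<lambda>y. Q (y, s)) x)) \<partial>U \<partial>P)"
    unfolding conditional_output_entropy_def
  proof (intro nn_integral_cong shannon_entropy_distr_fiber_prob U)
    fix s assume "s \<in> space P"
    then show "(\<lambda>x. Q (x, s)) \<in> borel_measurable U" "countable (range (\<lambda>x. Q (x, s)))"
      using rq by (auto simp: randomized_quantizer_def)
  qed
  also have "\<dots> = (\<integral>\<^sup>+w. ennreal (- log 2 (fiber_prob U (\<lambda>y. Q (y, snd w)) (fst w))) \<partial>(U \<Otimes>\<^sub>M P))"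
    by (subst nn_integral_snd[symmetric]) auto
  finally show ?thesis .
qed

section \<open>Volumes of superlevel sets against volumes of cells\<close>

lemma emeasure_superlevel_set:
  fixes f :: "real ^ 'n \<Rightarrow> real"
  assumes [measurable]: "f \<in> borel_measurable borel"
    and "(\<integral>\<^sup>+z. ennreal (f z) \<partial>lborel) = 1" and "0 < t"
  shows "emeasure lborel {z. t \<le> f z} = ennreal (measure lebesgue (superlevel_set f t))"
  \<comment> \<open>\<open>measure\<close> is 0 on sets of infinite volume; Markov's inequality
    excludes that default for t > 0.\<close>
  using emeasure_superlevel_finite[of f lborel t] assms
  by (subst emeasure_eq_ennreal_measure) (auto simp: superlevel_set_def measure_completion less_top)

lemma measurable_measure_superlevel_set:
  fixes f :: "real ^ 'n \<Rightarrow> real"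
  assumes [measurable]: "f \<in> borel_measurable borel"
  shows "(\<lambda>t. measure lebesgue (superlevel_set f t)) \<in> borel_measurable borel"
proof -
  have "{w \<in> space (borel \<Otimes>\<^sub>M lborel). fst w \<le> f (snd w)} \<in> sets (borel \<Otimes>\<^sub>M lborel)"
    by measurable
  from lborel.measurable_emeasure_Pair[OF this]
  have "(\<lambda>t. enn2real (emeasure lborel {z. t \<le> f z})) \<in> borel_measurable borel"
    by (simp add: vimage_def space_pair_measure)
  then show ?thesis
    by (simp add: superlevel_set_def measure_def emeasure_completion)
qed

text \<open>The bathtub function \<open>\<eta>\<close> links the two sides. Its mean under the law
  of the error is at least the capped layer integral by optimality, and at most the capped cell
  average by the bound on each cell, applied in every state.\<close>

lemma nn_integral_min_superlevel_le:
  fixes Q :: "(real ^ 'n) \<times> 's \<Rightarrow> real ^ 'n" and f :: "real ^ 'n \<Rightarrow> real"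
  assumes rq: "randomized_quantizer P Q" and f: "\<And>z. 0 \<le> f z"
    and A: "A \<in> sets lebesgue" "0 < emeasure lebesgue A" "emeasure lebesgue A < \<infinity>"
    and D: "distributed (uniform_measure lebesgue A \<Otimes>\<^sub>M P) lborel (\<lambda>(x, s). Q (x, s) - x) (\<lambda>z. ennreal (f z))"
    and mf[measurable]: "f \<in> borel_measurable borel" and int_f: "(\<integral>\<^sup>+z. ennreal (f z) \<partial>lborel) = 1"
    and c: "0 < c"
  defines "U \<equiv> uniform_measure lebesgue A"
  defines "m \<equiv> \<lambda>w. measure lebesgue A * fiber_prob U (\<lambda>y. Q (y, snd w)) (fst w)"
  shows "(\<integral>\<^sup>+t\<in>{0<..}. ennreal (min (measure lebesgue (superlevel_set f t)) c) \<partial>lborel)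
    \<le> (\<integral>\<^sup>+w. ennreal (1 / m w) * ennreal (min (m w) c) \<partial>(U \<Otimes>\<^sub>M P))"
proof -
  have U: "prob_space U" unfolding U_def by (rule prob_space_uniform_lebesgue[OF A(2,3)])
  have sets_U[measurable_cong]: "sets U = sets lebesgue" by (simp add: U_def)
  interpret U: prob_space U by fact
  interpret P: prob_space P using rq by (simp add: randomized_quantizer_def)
  interpret pair_sigma_finite U P ..
  have Q[measurable]: "Q \<in> borel_measurable (lebesgue \<Otimes>\<^sub>M P)"
    using rq by (simp add: randomized_quantizer_def)
  have [measurable]: "m \<in> borel_measurable (U \<Otimes>\<^sub>M P)"
    using measurable_fiber_prob_state[OF rq U sets_U] unfolding m_def by measurable
  have X: "(\<lambda>(x, s). Q (x, s) - x) \<in> borel_measurable (U \<Otimes>\<^sub>M P)"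
    using distributed_measurable[OF D] by (simp add: U_def)
  obtain \<eta> :: "real ^ 'n \<Rightarrow> ennreal" where \<eta>: "\<eta> \<in> borel_measurable lborel" "\<And>z. \<eta> z \<le> 1"
      "(\<integral>\<^sup>+z. \<eta> z \<partial>lborel) \<le> ennreal c"
      "(\<integral>\<^sup>+t\<in>{0<..}. ennreal (min (measure lborel {z\<in>space lborel. t \<le> f z}) c) \<partial>lborel)
        \<le> (\<integral>\<^sup>+z. \<eta> z * ennreal (f z) \<partial>lborel)"
    by (rule bathtub[of lborel f c]) (simp_all add: int_f f c sigma_finite_lborel)
  then have [measurable]: "\<eta> \<in> borel_measurable borel" by simp
  have "(\<integral>\<^sup>+t\<in>{0<..}. ennreal (min (measure lebesgue (superlevel_set f t)) c) \<partial>lborel)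
      \<le> (\<integral>\<^sup>+z. \<eta> z * ennreal (f z) \<partial>lborel)"
    using \<eta>(4) by (simp add: superlevel_set_def measure_completion)
  also have "\<dots> = (\<integral>\<^sup>+z. \<eta> z \<partial>density lborel (\<lambda>z. ennreal (f z)))"
    by (subst nn_integral_density) (auto simp: mult.commute)
  also have "\<dots> = (\<integral>\<^sup>+w. \<eta> ((\<lambda>(x, s). Q (x, s) - x) w) \<partial>(U \<Otimes>\<^sub>M P))"
    using X by (simp add: distributed_distr_eq_density[OF D, symmetric] nn_integral_distr U_def)
  also have "\<dots> = (\<integral>\<^sup>+s. \<integral>\<^sup>+x. \<eta> (Q (x, s) - x) \<partial>U \<partial>P)"
    using X by (subst nn_integral_snd[symmetric]) auto
  also have "\<dots> \<le> (\<integral>\<^sup>+s. \<integral>\<^sup>+x. ennreal (1 / m (x, s)) * ennreal (min (m (x, s)) c) \<partial>U \<partial>P)"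
  proof (rule nn_integral_mono)
    fix s assume s: "s \<in> space P"
    then have "(\<lambda>x. Q (x, s)) \<in> borel_measurable lebesgue" "countable (range (\<lambda>x. Q (x, s)))"
      using rq by (auto simp: randomized_quantizer_def)
    from nn_integral_error_le[OF A this \<open>\<eta> \<in> borel_measurable borel\<close> \<eta>(2,3)] c
    show "(\<integral>\<^sup>+x. \<eta> (Q (x, s) - x) \<partial>U) \<le> (\<integral>\<^sup>+x. ennreal (1 / m (x, s)) * ennreal (min (m (x, s)) c) \<partial>U)"
      by (simp add: m_def U_def)
  qed
  also have "\<dots> = (\<integral>\<^sup>+w. ennreal (1 / m w) * ennreal (min (m w) c) \<partial>(U \<Otimes>\<^sub>M P))"
    by (subst nn_integral_snd[symmetric]) auto
  finally show ?thesis .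
qed

lemma AE_fiber_prob_state_pos:
  fixes Q :: "(real ^ 'n) \<times> 's \<Rightarrow> real ^ 'n"
  assumes rq: "randomized_quantizer P Q" and U: "prob_space U" and sets: "sets U = sets lebesgue"
  shows "AE w in U \<Otimes>\<^sub>M P. 0 < fiber_prob U (\<lambda>y. Q (y, snd w)) (fst w)"
proof -
  interpret U: prob_space U by fact
  interpret P: prob_space P using rq by (simp add: randomized_quantizer_def)
  interpret pair_sigma_finite U P ..
  note [measurable] = measurable_fiber_prob_state[OF assms]
  have [measurable]: "Q \<in> borel_measurable (U \<Otimes>\<^sub>M P)"
    using rq measurable_cong_sets[OF sets_pair_measure_cong[OF sets refl] refl]
    by (auto simp: randomized_quantizer_def)
  let ?N = "{w\<in>space (U \<Otimes>\<^sub>M P). \<not> 0 < fiber_prob U (\<lambda>y. Q (y, snd w)) (fst w)}"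
  have "emeasure (U \<Otimes>\<^sub>M P) ?N = (\<integral>\<^sup>+s. \<integral>\<^sup>+x. indicator ?N (x, s) \<partial>U \<partial>P)"
    by (subst nn_integral_snd) auto
  also have "\<dots> = (\<integral>\<^sup>+s. 0 \<partial>P)"
  proof (intro nn_integral_cong)
    fix s assume "s \<in> space P"
    then have "AE x in U. 0 < fiber_prob U (\<lambda>y. Q (y, s)) x"
      using rq by (intro AE_fiber_prob_pos U) (auto simp: randomized_quantizer_def)
    then have "AE x in U. indicator ?N (x, s) = (0 :: ennreal)"
      by eventually_elim auto
    then show "(\<integral>\<^sup>+x. indicator ?N (x, s) \<partial>U) = 0"
      by (subst nn_integral_cong_AE) auto
  qed
  finally have "?N \<in> null_sets (U \<Otimes>\<^sub>M P)" by (auto intro!: null_setsI)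
  then show ?thesis by (rule AE_I'[where N="?N"]) auto
qed

section \<open>The entropy bound for a uniform input\<close>

lemma conditional_output_entropy_ge:
  fixes Q :: "(real ^ 'n) \<times> 's \<Rightarrow> real ^ 'n" and f :: "real ^ 'n \<Rightarrow> real"
  assumes rq: "randomized_quantizer P Q" and f: "\<And>z. 0 \<le> f z"
    and A: "A \<in> sets lebesgue" "0 < emeasure lebesgue A" "emeasure lebesgue A < \<infinity>"
    and D: "distributed (uniform_measure lebesgue A \<Otimes>\<^sub>M P) lborel (\<lambda>(x, s). Q (x, s) - x) (\<lambda>z. ennreal (f z))"
  shows "ereal (log 2 (measure lebesgue A)) - layered_entropy f
    \<le> enn2ereal (conditional_output_entropy (uniform_measure lebesgue A) P Q)"
proof -
  define U where "U = uniform_measure lebesgue A"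
  have U: "prob_space U" unfolding U_def by (rule prob_space_uniform_lebesgue[OF A(2,3)])
  have sets_U[measurable_cong]: "sets U = sets lebesgue" by (simp add: U_def)
  interpret U: prob_space U by fact
  interpret P: prob_space P using rq by (simp add: randomized_quantizer_def)
  interpret UP: pair_prob_space U P ..
  have mf[measurable]: "f \<in> borel_measurable borel"
    using distributed_real_measurable[OF f D] by simp
  \<comment> \<open>That f has total mass 1 follows from its being the density of the image of a
    probability measure.\<close>
  have "prob_space (distr (U \<Otimes>\<^sub>M P) lborel (\<lambda>(x, s). Q (x, s) - x))"
    using distributed_measurable[OF D] unfolding U_def[symmetric] by (rule UP.P.prob_space_distr)
  then have "prob_space (density lborel (\<lambda>z. ennreal (f z)))"
    using distributed_distr_eq_density[OF D] by (simp add: U_def)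
  from prob_space.emeasure_space_1[OF this] have int_f: "(\<integral>\<^sup>+z. ennreal (f z) \<partial>lborel) = 1"
    by (simp add: emeasure_density)
  have "emeasure lebesgue A = ennreal (measure lebesgue A)"
    using A by (intro emeasure_eq_ennreal_measure) auto
  with A have pos: "0 < measure lebesgue A" by (simp add: ennreal_less_zero_iff)

  define l where "l = log 2 (measure lebesgue A)"
  define p where "p w = fiber_prob U (\<lambda>y. Q (y, snd w)) (fst w)" for w
  define m where "m w = measure lebesgue A * p w" for w
  define v where "v t = measure lebesgue (superlevel_set f t)" for t
  have [measurable]: "p \<in> borel_measurable (U \<Otimes>\<^sub>M P)"
    using measurable_fiber_prob_state[OF rq U sets_U] by (simp add: p_def[abs_def])
  then have [measurable]: "m \<in> borel_measurable (U \<Otimes>\<^sub>M P)"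
    unfolding m_def by measurable
  have [measurable]: "v \<in> borel_measurable borel"
    unfolding v_def by (rule measurable_measure_superlevel_set) measurable
  have p_pos: "AE w in U \<Otimes>\<^sub>M P. 0 < p w"
    unfolding p_def by (rule AE_fiber_prob_state_pos[OF rq U sets_U])
  have p: "0 \<le> p w" "p w \<le> 1" for w by (auto simp: p_def fiber_prob_def)
  \<comment> \<open>On a cell of volume 0 the convention 1 / 0 = 0 makes the product 0 instead of 1;
    such cells are hit with probability 0.\<close>
  have mean_m: "(\<integral>\<^sup>+w. ennreal (1 / m w) * ennreal (m w) \<partial>(U \<Otimes>\<^sub>M P)) = 1"
  proof -
    have "(\<integral>\<^sup>+w. ennreal (1 / m w) * ennreal (m w) \<partial>(U \<Otimes>\<^sub>M P)) = (\<integral>\<^sup>+w. 1 \<partial>(U \<Otimes>\<^sub>M P))"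
      using p_pos by (intro nn_integral_cong_AE, eventually_elim)
        (use pos in \<open>simp add: m_def ennreal_mult'[symmetric]\<close>)
    then show ?thesis by (simp add: UP.P.emeasure_space_1)
  qed
  have mean_v: "(\<integral>\<^sup>+t. indicator {0<..} t * ennreal (v t) \<partial>lborel) = 1"
  proof -
    have "(\<integral>\<^sup>+t. indicator {0<..} t * ennreal (v t) \<partial>lborel)
        = (\<integral>\<^sup>+t\<in>{0<..}. emeasure lborel {z. t \<le> f z} \<partial>lborel)"
      by (intro nn_integral_cong)
         (auto simp: v_def emeasure_superlevel_set[OF mf int_f] split: split_indicator)
    then show ?thesis
      using nn_integral_layer_cake[OF sigma_finite_lborel, of f "\<lambda>_. 1"] f by (simp add: int_f)
  qed
  define H Pv Nv Pm Nm
    where "H = conditional_output_entropy U P Q"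
      and "Pv = (\<integral>\<^sup>+t\<in>{0<..}. ennreal (v t * log 2 (v t)) \<partial>lborel)"
      and "Nv = (\<integral>\<^sup>+t\<in>{0<..}. ennreal (- (v t * log 2 (v t))) \<partial>lborel)"
      and "Pm = (\<integral>\<^sup>+w. ennreal (log 2 (m w)) \<partial>(U \<Otimes>\<^sub>M P))"
      and "Nm = (\<integral>\<^sup>+w. ennreal (- log 2 (m w)) \<partial>(U \<Otimes>\<^sub>M P))"
  have "(\<integral>\<^sup>+w. ennreal (1 / m w) * ennreal (m w * log 2 (m w)) \<partial>(U \<Otimes>\<^sub>M P))
      + (\<integral>\<^sup>+t. indicator {0<..} t * ennreal (- (v t * log 2 (v t))) \<partial>lborel)
    \<le> (\<integral>\<^sup>+t. indicator {0<..} t * ennreal (v t * log 2 (v t)) \<partial>lborel)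
      + (\<integral>\<^sup>+w. ennreal (1 / m w) * ennreal (- (m w * log 2 (m w))) \<partial>(U \<Otimes>\<^sub>M P))"
  proof (rule entropy_majorization[OF _ sigma_finite_lborel _ _ _ _ _ _ mean_m mean_v])
    show "sigma_finite_measure (U \<Otimes>\<^sub>M P)" by unfold_locales
    show "0 \<le> m w" for w using pos p by (simp add: m_def)
    show "(\<integral>\<^sup>+t. indicator {0<..} t * ennreal (min (v t) c) \<partial>lborel)
      \<le> (\<integral>\<^sup>+w. ennreal (1 / m w) * ennreal (min (m w) c) \<partial>(U \<Otimes>\<^sub>M P))" if "0 < c" for c
      using nn_integral_min_superlevel_le[OF rq f A D mf int_f that]
      by (simp add: m_def p_def v_def U_def mult.commute[of "indicator _ _"])
  qed (auto simp: v_def measurable_measure_superlevel_set)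
  moreover have "(\<integral>\<^sup>+w. ennreal (1 / m w) * ennreal (m w * log 2 (m w)) \<partial>(U \<Otimes>\<^sub>M P)) = Pm"
    unfolding Pm_def using p_pos by (intro nn_integral_cong_AE, eventually_elim)
      (use pos in \<open>simp add: m_def ennreal_mult'[symmetric]\<close>)
  moreover have "(\<integral>\<^sup>+w. ennreal (1 / m w) * ennreal (- (m w * log 2 (m w))) \<partial>(U \<Otimes>\<^sub>M P)) = Nm"
    unfolding Nm_def using p_pos by (intro nn_integral_cong_AE, eventually_elim)
      (use pos in \<open>simp add: m_def ennreal_mult'[symmetric]\<close>)
  ultimately have maj: "Pm + Nv \<le> Pv + Nm"
    by (simp add: Pv_def Nv_def mult.commute[of "indicator _ _"])
  have log_m: "AE w in U \<Otimes>\<^sub>M P. log 2 (m w) = l + log 2 (p w) \<and> log 2 (p w) \<le> 0"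
    using p_pos by eventually_elim (use pos p(2) in \<open>auto simp: m_def l_def log_mult\<close>)
  \<comment> \<open>This is the identity H = l - E[log m], with every part moved to the side where
    it is nonnegative.\<close>
  have H: "H + Pm + ennreal (- l) = Nm + ennreal l"
  proof -
    have "H + Pm + ennreal (- l)
        = (\<integral>\<^sup>+w. ennreal (- log 2 (p w)) + ennreal (log 2 (m w)) + ennreal (- l) \<partial>(U \<Otimes>\<^sub>M P))"
      unfolding H_def Pm_def conditional_output_entropy_fiber_prob[OF rq U sets_U] p_def[symmetric]
      by (simp add: nn_integral_add UP.P.emeasure_space_1)
    also have "\<dots> = (\<integral>\<^sup>+w. ennreal (- log 2 (m w)) + ennreal l \<partial>(U \<Otimes>\<^sub>M P))"
    proof (intro nn_integral_cong_AE)
      have split: "ennreal (- b) + ennreal a + ennreal (- l) = ennreal (- a) + ennreal l"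
        if "a = l + b \<and> b \<le> 0" for a b
        using that by (cases "0 \<le> a"; cases "0 \<le> l")
          (auto simp: ennreal_neg ennreal_plus[symmetric] simp del: ennreal_plus)
      from log_m show "AE w in U \<Otimes>\<^sub>M P. ennreal (- log 2 (p w)) + ennreal (log 2 (m w)) + ennreal (- l)
          = ennreal (- log 2 (m w)) + ennreal l"
        by eventually_elim (rule split)
    qed
    also have "\<dots> = Nm + ennreal l"
      unfolding Nm_def by (simp add: nn_integral_add UP.P.emeasure_space_1)
    finally show ?thesis .
  qed
  \<comment> \<open>No cell is larger than the input set, so the positive part of the mean
    log-volume is finite; only the negative part can diverge.\<close>
  have "Pm \<le> (\<integral>\<^sup>+w. ennreal l \<partial>(U \<Otimes>\<^sub>M P))"
    unfolding Pm_def using log_m by (intro nn_integral_mono_AE, eventually_elim) (auto intro!: ennreal_leI)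
  then have Pm: "Pm \<le> ennreal l" by (simp add: UP.P.emeasure_space_1)
  \<comment> \<open>If \<open>Pv\<close> is infinite, the layered entropy is \<infinity> (also when
    \<open>Nv\<close> is infinite, by the convention of \<open>ereal\<close>) and the left side is
    -\<infinity>. If \<open>H\<close> is infinite the bound is trivial. Otherwise the identity for
    \<open>H\<close> makes \<open>Nm\<close> finite, majorization then makes \<open>Nv\<close>
    finite, and the claim is arithmetic of reals.\<close>
  have "ereal l - (enn2ereal Pv - enn2ereal Nv) \<le> enn2ereal H"
  proof (cases "Pv = \<top>")
    case False
    then obtain a where a: "Pv = ennreal a" "0 \<le> a" by (cases Pv) auto
    obtain b where b: "Pm = ennreal b" "0 \<le> b" using Pm by (cases Pm) (auto simp: top_unique)
    show ?thesis
    proof (cases "H = \<top>")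
      case False
      then obtain h where h: "H = ennreal h" "0 \<le> h" by (cases H) auto
      have "Nm \<noteq> \<top>" using H h b by (auto simp: ennreal_plus[symmetric] simp del: ennreal_plus)
      then obtain n where n: "Nm = ennreal n" "0 \<le> n" by (cases Nm) auto
      have "Nv \<noteq> \<top>" using maj a b n by (auto simp: top_unique ennreal_plus[symmetric] simp del: ennreal_plus)
      then obtain k where k: "Nv = ennreal k" "0 \<le> k" by (cases Nv) auto
      have "b + k \<le> a + n"
        using maj a b k n by (simp add: ennreal_plus[symmetric] del: ennreal_plus)
      moreover have "h + b = n + l"
        using H h b n by (cases "0 \<le> l") (auto simp: ennreal_neg ennreal_plus[symmetric] simp del: ennreal_plus)
      ultimately show ?thesis
        using a h k by (simp add: enn2ereal_ennreal)
    qed simp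
  qed simp
  then show ?thesis
    by (simp add: layered_entropy_def Let_def Pv_def Nv_def H_def v_def l_def U_def)
qed

text \<open>A mixture of identical laws is that law: by Tonelli the error is averaged over the state
  first, with a result independent of x. This reduces the pointwise hypothesis of the second claim
  to the hypothesis of the first.\<close>

lemma distributed_uniform_input:
  fixes Q :: "(real ^ 'n) \<times> 's \<Rightarrow> real ^ 'n" and g :: "real ^ 'n \<Rightarrow> ennreal"
  assumes rq: "randomized_quantizer P Q" and U: "prob_space U" and sets_U[measurable_cong]: "sets U = sets lebesgue"
    and D: "\<And>x. distributed P lborel (\<lambda>s. Q (x, s) - x) g"
  shows "distributed (U \<Otimes>\<^sub>M P) lborel (\<lambda>(x, s). Q (x, s) - x) g"
proof -
  interpret U: prob_space U by fact
  interpret P: prob_space P using rq by (simp add: randomized_quantizer_def)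
  interpret UP: pair_sigma_finite U P ..
  have [measurable]: "Q \<in> borel_measurable (lebesgue \<Otimes>\<^sub>M P)"
    using rq by (simp add: randomized_quantizer_def)
  have [measurable]: "(\<lambda>x. x) \<in> borel_measurable lebesgue" by (simp add: measurable_completion)
  have g[measurable]: "g \<in> borel_measurable borel"
    using distributed_borel_measurable[OF D] by simp
  have X[measurable]: "(\<lambda>(x, s). Q (x, s) - x) \<in> borel_measurable (U \<Otimes>\<^sub>M P)" by measurable
  have "distr (U \<Otimes>\<^sub>M P) lborel (\<lambda>(x, s). Q (x, s) - x) = density lborel g"
  proof (rule measure_eqI)
    fix E assume "E \<in> sets (distr (U \<Otimes>\<^sub>M P) lborel (\<lambda>(x, s). Q (x, s) - x))"
    then have [measurable]: "E \<in> sets borel" by simp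
    have "emeasure (distr (U \<Otimes>\<^sub>M P) lborel (\<lambda>(x, s). Q (x, s) - x)) E
        = (\<integral>\<^sup>+w. indicator E ((\<lambda>(x, s). Q (x, s) - x) w) \<partial>(U \<Otimes>\<^sub>M P))"
      by (subst nn_integral_distr[of _ _ lborel, symmetric]) auto
    also have "\<dots> = (\<integral>\<^sup>+x. \<integral>\<^sup>+s. indicator E (Q (x, s) - x) \<partial>P \<partial>U)"
      using P.nn_integral_fst[where f="\<lambda>w. indicator E ((\<lambda>(x, s). Q (x, s) - x) w)" and ?M1.0=U] by simp
    also have "\<dots> = (\<integral>\<^sup>+x. emeasure (density lborel g) E \<partial>U)"
    proof (rule nn_integral_cong)
      fix x
      have "emeasure (density lborel g) E = (\<integral>\<^sup>+z. indicator E z \<partial>distr P lborel (\<lambda>s. Q (x, s) - x))"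
        by (simp add: distributed_distr_eq_density[OF D])
      also have "\<dots> = (\<integral>\<^sup>+s. indicator E (Q (x, s) - x) \<partial>P)"
        by (rule nn_integral_distr[OF distributed_measurable[OF D]]) simp
      finally show "(\<integral>\<^sup>+s. indicator E (Q (x, s) - x) \<partial>P) = emeasure (density lborel g) E" ..
    qed
    finally show "emeasure (distr (U \<Otimes>\<^sub>M P) lborel (\<lambda>(x, s). Q (x, s) - x)) E = emeasure (density lborel g) E"
      by (simp add: U.emeasure_space_1)
  qed simp
  then show ?thesis using X by (simp add: distributed_def)
qed

theorem theorem18:
  fixes P :: "'s measure"
    and Q :: "(real ^ 'n) \<times> 's \<Rightarrow> real ^ 'n"
    and f :: "real ^ 'n \<Rightarrow> real"
  assumes "randomized_quantizer P Q"
    and "\<And>z. 0 \<le> f z"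
  shows "(\<forall>A. A \<in> sets lebesgue \<and> 0 < emeasure lebesgue A \<and> emeasure lebesgue A < \<infinity> \<and>
              distributed (uniform_measure lebesgue A \<Otimes>\<^sub>M P) lborel (\<lambda>(x, s). Q (x, s) - x) (\<lambda>z. ennreal (f z))
            \<longrightarrow> enn2ereal (conditional_output_entropy (uniform_measure lebesgue A) P Q)
                  \<ge> ereal (log 2 (measure lebesgue A)) - layered_entropy f)
       \<and> ((\<forall>x. distributed P lborel (\<lambda>s. Q (x, s) - x) (\<lambda>z. ennreal (f z)))
            \<longrightarrow> normalized_entropy P Q \<ge> - layered_entropy f)"
proof (intro conjI allI impI; (elim conjE)?)
  fix A :: "(real ^ 'n) set"
  assume "A \<in> sets lebesgue" "0 < emeasure lebesgue A" "emeasure lebesgue A < \<infinity>"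
    "distributed (uniform_measure lebesgue A \<Otimes>\<^sub>M P) lborel (\<lambda>(x, s). Q (x, s) - x) (\<lambda>z. ennreal (f z))"
  then show "enn2ereal (conditional_output_entropy (uniform_measure lebesgue A) P Q)
      \<ge> ereal (log 2 (measure lebesgue A)) - layered_entropy f"
    by (rule conditional_output_entropy_ge[OF assms])
next
  assume D: "\<forall>x. distributed P lborel (\<lambda>s. Q (x, s) - x) (\<lambda>z. ennreal (f z))"
  let ?h = "\<lambda>B. enn2ereal (conditional_output_entropy (uniform_measure lebesgue B) P Q)
      - ereal (log 2 (measure lebesgue B))"
  have "- layered_entropy f \<le> ?h ((\<lambda>x. \<tau> *\<^sub>R x) ` cball 0 1)" if "\<tau> > 0" for \<tau> :: real
  proof -
    define B where "B = (\<lambda>x. \<tau> *\<^sub>R x) ` (cball 0 1 :: (real ^ 'n) set)"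
    have B: "B = cball 0 \<tau>"
      unfolding B_def using that cball_scale[of \<tau> 0 1] by simp
    have A: "B \<in> sets lebesgue" "0 < emeasure lebesgue B" "emeasure lebesgue B < \<infinity>"
      using that emeasure_lborel_cball_finite[of 0 \<tau>]
      by (auto simp: B emeasure_completion emeasure_cball)
    have "ereal (log 2 (measure lebesgue B)) - layered_entropy f
        \<le> enn2ereal (conditional_output_entropy (uniform_measure lebesgue B) P Q)"
      using D by (intro conditional_output_entropy_ge assms A distributed_uniform_input
          prob_space_uniform_lebesgue) auto
    \<comment> \<open>The volume of the ball is positive and finite, so its logarithm is a real
      number and can be moved across the inequality even when the entropies are infinite.\<close>
    then have "- layered_entropy f \<le> ?h B"
      by (cases "layered_entropy f"; cases "enn2ereal (conditional_output_entropy (uniform_measure lebesgue B) P Q)") auto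
    then show ?thesis by (simp add: B_def)
  qed
  then have "\<forall>\<^sub>F \<tau> in at_top. - layered_entropy f \<le> ?h ((\<lambda>x. \<tau> *\<^sub>R x) ` cball 0 1)"
    by (rule eventually_mono[OF eventually_gt_at_top[of 0]])
  then show "- layered_entropy f \<le> normalized_entropy P Q"
    unfolding normalized_entropy_def Let_def
    \<comment> \<open>The bound holds for every positive radius, hence already for the lower
      limit.\<close>
    by (intro order_trans[OF Liminf_bounded Liminf_le_Limsup]) auto
qed

end
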